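(* Let $\mathcal{C}$ be a combinatorial class with a composition rule $\blacktriangleleft\,:\mathcal{C}\times\mathcal{C}\to\mathrm{MSet}(\mathcal{C})$ and a decomposition rule $\langle\cdot\rangle:\mathcal{C}\to\mathrm{MSet}(\mathcal{C}\times\mathcal{C})$ satisfying the composition conditions (C1)–(C3) and the decomposition conditions (D1)–(D3) written out in the context, with $\text{\O}\in\mathcal{C}$ denoting the neutral and void object. Let $\mathbb{K}$ be a field and $\mathscr{C}=\mathbb{K}\,\mathcal{C}$ the vector space with basis $\mathcal{C}$, equipped with the algebra structure $(\mathscr{C},+,*,\text{\O})$ and the co-algebra structure $(\mathscr{C},+,\Delta,\varepsilon)$ defined on basis elements by $$\Gamma_2*\Gamma_1=\sum_{\Gamma\in\Gamma_2\blacktriangleleft\Gamma_1}\Gamma,\qquad \Delta(\Gamma)=\sum_{(\Gamma'',\Gamma')\in\langle\Gamma\rangle}\Gamma''\otimes\Gamma',\qquad \varepsilon(\Gamma)=\begin{cases}1&\text{if }\Gamma=\text{\O},\\0&\text{otherwise.}\end{cases}$$ Suppose that composition and decomposition are compatible in the sense that for all $\Gamma_2,\Gamma_1\in\mathcal{C}$ the following equality of multisets holds: $$\langle\Gamma_2\blacktriangleleft\Gamma_1\rangle=\biguplus_{\substack{(\Gamma_2'',\Gamma_2')\in\langle\Gamma_2\rangle\\(\Gamma_1'',\Gamma_1')\in\langle\Gamma_1\rangle}}(\Gamma_2''\blacktriangleleft\Gamma_1'')\times(\Gamma_2'\blacktriangleleft\Gamma_1').$$ Then the algebra and co-algebra structures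 on $\mathscr{C}$ are compatible and combine into a bi-algebra $(\mathscr{C},+,*,\text{\O},\Delta,\varepsilon)$.
   Context: A multiset is a pair $(A,m)$ with $A$ a set and $m:A\to\mathbb{N}_{\geq 1}$ a multiplicity function; equality of multisets means equality of underlying sets and of multiplicities. The sum $\uplus$ of multisets adds multiplicities, and the product $A\times B$ has multiplicities $m_{A\times B}((a,b))=m_A(a)\,m_B(b)$. Sums and unions indexed by multisets count elements with multiplicity. A combinatorial class $\mathcal{C}$ is a denumerable collection of objects. $\mathrm{MSet}(X)$ denotes the class of multisets of elements of $X$. A composition rule is a mapping $\blacktriangleleft\,:\mathcal{C}\times\mathcal{C}\to\mathrm{MSet}(\mathcal{C})$, extended to multisets by $A\blacktriangleleft B=\biguplus_{a\in A,\,b\in B}a\blacktriangleleft b$ (a single object being identified with a singleton multiset). A decomposition rule is a mapping $\langle\cdot\rangle:\mathcal{C}\to\mathrm{MSet}(\mathcal{C}\times\mathcal{C})$, extended to multisets by $\langle A\rangle=\biguplus_{a\in A}\langle a\rangle$. Conditions on composition: (C1) $\Gamma_2\blacktriangleleft\Gamma_1$ is finite for all $\Gamma_2,\Gamma_1\in\mathcal{C}$. (C2) $\Gamma_3\blacktriangleleft(\Gamma_2\blacktriangleleft\Gamma_1)=(\Gamma_3\blacktriangleleft\Gamma_2)\blacktriangleleft\Gamma_1$ for all $\Gamma_3,\Gamma_2,\Gamma_1\in\mathcal{C}$. (C3) The neutral object $\text{\O}\in\mathcal{C}$ satisfies $\text{\O}\blacktriangleleft\Gamma=\{\Gamma\}=\Gamma\blacktriangleleft\text{\O}$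 for all $\Gamma\in\mathcal{C}$. Conditions on decomposition: (D1) $\langle\Gamma\rangle$ is finite for all $\Gamma\in\mathcal{C}$. (D2) $\biguplus_{(\Gamma'',\Gamma')\in\langle\Gamma\rangle}\{\Gamma''\}\times\langle\Gamma'\rangle=\biguplus_{(\Gamma'',\Gamma')\in\langle\Gamma\rangle}\langle\Gamma''\rangle\times\{\Gamma'\}$ as multisets of triples, for all $\Gamma\in\mathcal{C}$. (D3) The void object $\text{\O}\in\mathcal{C}$ satisfies $\langle\text{\O}\rangle=\{(\text{\O},\text{\O})\}$ and, for every $\Gamma\neq\text{\O}$, the pairs in $\langle\Gamma\rangle$ having a component equal to $\text{\O}$ or to $\Gamma$ are exactly $(\text{\O},\Gamma)$ and $(\Gamma,\text{\O})$, each with multiplicity one. The neutral object of (C3) and the void object of (D3) are the same object, with common notation $\text{\O}$. *)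

theory Defs
  imports
    Complex_Main
    "HOL-Library.Multiset"
    "HOL-Library.Poly_Mapping"
    "HOL-Library.Countable"
begin

section \<open>Composition and decomposition rules\<close>

text \<open>
  The library type \<open>'a multiset\<close> only has finite multisets. A rule takes values in arbitrary
  multisets, given by their multiplicity function \<open>'a \<Rightarrow> nat\<close> (the underlying set is where it is
  positive); finiteness is then an explicit condition. \<open>Abs_multiset\<close> turns a finite one into a
  library multiset and is unspecified on an infinite one, so the conditions below that use it are
  only meaningful together with finiteness.
\<close>

type_synonym 'a multiplicity = "'a \<Rightarrow> nat"

definition finite_multiplicity :: "'a multiplicity \<Rightarrow> bool" where
  "finite_multiplicity m \<longleftrightarrow> finite {x. m x > 0}"

lemma count_Abs_multiset_finite:
  "finite_multiplicity m \<Longrightarrow> count (Abs_multiset m) = m"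
  by (simp add: finite_multiplicity_def)

definition mset_times :: "'a multiset \<Rightarrow> 'b multiset \<Rightarrow> ('a \<times> 'b) multiset" where
  "mset_times A B = (\<Sum>a\<in>#A. {#(a, b). b \<in># B#})"

lemma count_mset_times: "count (mset_times A B) (a, b) = count A a * count B b"
proof (induction A)
  case empty
  then show ?case by (simp add: mset_times_def)
next
  case (add x A)
  have "count {#(x, b). b \<in># B#} (a, b) = (if x = a then count B b else 0)"
    by (induction B) auto
  with add show ?case by (simp add: mset_times_def)
qed

definition compose ::
    "('c \<Rightarrow> 'c \<Rightarrow> 'c multiplicity) \<Rightarrow> 'c multiset \<Rightarrow> 'c multiset \<Rightarrow> 'c multiset" where
  "compose \<kappa> A B = (\<Sum>a\<in>#A. \<Sum>b\<in>#B. Abs_multiset (\<kappa> a b))"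

definition decompose ::
    "('c \<Rightarrow> ('c \<times> 'c) multiplicity) \<Rightarrow> 'c multiset \<Rightarrow> ('c \<times> 'c) multiset" where
  "decompose \<delta> A = (\<Sum>a\<in>#A. Abs_multiset (\<delta> a))"

locale composition_rule =
  fixes \<kappa> :: "'c \<Rightarrow> 'c \<Rightarrow> 'c multiplicity" and void :: 'c
  assumes finite_comp: "finite_multiplicity (\<kappa> \<Gamma>2 \<Gamma>1)"
    and comp_assoc: "compose \<kappa> {#\<Gamma>3#} (compose \<kappa> {#\<Gamma>2#} {#\<Gamma>1#})
                       = compose \<kappa> (compose \<kappa> {#\<Gamma>3#} {#\<Gamma>2#}) {#\<Gamma>1#}"
    and comp_neutral_left: "compose \<kappa> {#void#} {#\<Gamma>#} = {#\<Gamma>#}"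
    and comp_neutral_right: "compose \<kappa> {#\<Gamma>#} {#void#} = {#\<Gamma>#}"

text \<open>Triples are nested to the right, hence the reassociation of \<open>('c \<times> 'c) \<times> 'c\<close> below.\<close>

locale decomposition_rule =
  fixes \<delta> :: "'c \<Rightarrow> ('c \<times> 'c) multiplicity" and void :: 'c
  assumes finite_decomp: "finite_multiplicity (\<delta> \<Gamma>)"
    and decomp_coassoc:
      "(\<Sum>(\<Gamma>'', \<Gamma>')\<in>#decompose \<delta> {#\<Gamma>#}. mset_times {#\<Gamma>''#} (decompose \<delta> {#\<Gamma>'#}))
         = image_mset (\<lambda>((a, b), c). (a, b, c))
             (\<Sum>(\<Gamma>'', \<Gamma>')\<in>#decompose \<delta> {#\<Gamma>#}. mset_times (decompose \<delta> {#\<Gamma>''#}) {#\<Gamma>'#})"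
    and decomp_void: "decompose \<delta> {#void#} = {#(void, void)#}"
    and decomp_trivial: "\<Gamma> \<noteq> void \<Longrightarrow>
      {#(\<Gamma>'', \<Gamma>') \<in># decompose \<delta> {#\<Gamma>#}. \<Gamma>'' \<in> {void, \<Gamma>} \<or> \<Gamma>' \<in> {void, \<Gamma>}#}
         = {#(void, \<Gamma>), (\<Gamma>, void)#}"

definition compatible_rules ::
    "('c \<Rightarrow> 'c \<Rightarrow> 'c multiplicity) \<Rightarrow> ('c \<Rightarrow> ('c \<times> 'c) multiplicity) \<Rightarrow> bool" where
  "compatible_rules \<kappa> \<delta> \<longleftrightarrow> (\<forall>\<Gamma>2 \<Gamma>1.
     decompose \<delta> (compose \<kappa> {#\<Gamma>2#} {#\<Gamma>1#})
       = (\<Sum>(\<Gamma>2'', \<Gamma>2')\<in>#decompose \<delta> {#\<Gamma>2#}. \<Sum>(\<Gamma>1'', \<Gamma>1')\<in>#decompose \<delta> {#\<Gamma>1#}.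
            mset_times (compose \<kappa> {#\<Gamma>2''#} {#\<Gamma>1''#}) (compose \<kappa> {#\<Gamma>2'#} {#\<Gamma>1'#})))"


section \<open>Vector spaces with a given basis\<close>

text \<open>
  The vector space over \<open>'k\<close> with basis \<open>'b\<close> is the space \<open>'b \<Rightarrow>\<^sub>0 'k\<close> of finitely supported
  functions. Its library multiplication, which would need a monoid structure on \<open>'b\<close>, plays no
  role here.
\<close>

definition vscale :: "'k::field \<Rightarrow> ('b \<Rightarrow>\<^sub>0 'k) \<Rightarrow> ('b \<Rightarrow>\<^sub>0 'k)" where
  "vscale c u = Poly_Mapping.map ((*) c) u"

definition basis :: "'b \<Rightarrow> ('b \<Rightarrow>\<^sub>0 'k::field)" where
  "basis b = Poly_Mapping.single b 1"

definition lin_ext ::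
    "('k::field \<Rightarrow> 'v::ab_group_add \<Rightarrow> 'v) \<Rightarrow> ('b \<Rightarrow> 'v) \<Rightarrow> ('b \<Rightarrow>\<^sub>0 'k) \<Rightarrow> 'v" where
  "lin_ext s f u = (\<Sum>b\<in>Poly_Mapping.keys u. s (Poly_Mapping.lookup u b) (f b))"

definition bilinear_map ::
    "('k::field \<Rightarrow> 'u::ab_group_add \<Rightarrow> 'u) \<Rightarrow> ('k \<Rightarrow> 'v::ab_group_add \<Rightarrow> 'v) \<Rightarrow>
     ('k \<Rightarrow> 'w::ab_group_add \<Rightarrow> 'w) \<Rightarrow> ('u \<Rightarrow> 'v \<Rightarrow> 'w) \<Rightarrow> bool" where
  "bilinear_map s1 s2 s3 f \<longleftrightarrow>
     (\<forall>v. Vector_Spaces.linear s1 s3 (\<lambda>u. f u v)) \<and> (\<forall>u. Vector_Spaces.linear s2 s3 (f u))"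

lemma lookup_vscale [simp]: "Poly_Mapping.lookup (vscale c u) b = c * Poly_Mapping.lookup u b"
  by (simp add: vscale_def map.rep_eq when_def)

lemma vector_space_vscale: "vector_space vscale"
  by unfold_locales (auto intro!: poly_mapping_eqI simp: lookup_add algebra_simps)

lemma lin_ext_superset:
  assumes "vector_space s" "finite A" "Poly_Mapping.keys u \<subseteq> A"
  shows "lin_ext s f u = (\<Sum>b\<in>A. s (Poly_Mapping.lookup u b) (f b))"
proof -
  interpret vector_space s by fact
  show ?thesis unfolding lin_ext_def
    by (rule sum.mono_neutral_left) (use assms in \<open>auto simp: in_keys_iff\<close>)
qed

lemma linear_lin_ext:
  fixes s :: "'k::field \<Rightarrow> 'v::ab_group_add \<Rightarrow> 'v" and f :: "'b \<Rightarrow> 'v"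
  assumes "vector_space s"
  shows "Vector_Spaces.linear vscale s (lin_ext s f)"
proof -
  interpret s: vector_space s by fact
  interpret v: vector_space vscale by (rule vector_space_vscale)
  show ?thesis
  proof unfold_locales
    fix u v :: "'b \<Rightarrow>\<^sub>0 'k"
    let ?A = "Poly_Mapping.keys u \<union> Poly_Mapping.keys v"
    have "Poly_Mapping.keys (u + v) \<subseteq> ?A" by (rule keys_add)
    then show "lin_ext s f (u + v) = lin_ext s f u + lin_ext s f v"
      by (simp add: lin_ext_superset[OF assms, of ?A] lookup_add s.scale_left_distrib sum.distrib)
  next
    fix c and u :: "'b \<Rightarrow>\<^sub>0 'k"
    have "Poly_Mapping.keys (vscale c u) \<subseteq> Poly_Mapping.keys u" by (auto simp: in_keys_iff)
    then show "lin_ext s f (vscale c u) = s c (lin_ext s f u)"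
      by (simp add: lin_ext_superset[OF assms, of "Poly_Mapping.keys u"] s.scale_sum_right)
  qed
qed

lemma lin_ext_basis [simp]: "vector_space s \<Longrightarrow> lin_ext s f (basis b) = f b"
  by (simp add: lin_ext_def basis_def vector_space.vector_space_assms(4))

lemma basis_expansion: "u = (\<Sum>b\<in>Poly_Mapping.keys u. vscale (Poly_Mapping.lookup u b) (basis b))"
  by (rule poly_mapping_eqI)
     (auto simp: lookup_sum basis_def lookup_single when_def sum.delta in_keys_iff
           if_distrib[of "\<lambda>x. _ * x"] cong: if_cong)

lemma linear_eq_lin_ext:
  assumes "Vector_Spaces.linear vscale s g"
  shows "g u = lin_ext s (\<lambda>b. g (basis b)) u"
proof -
  interpret Vector_Spaces.linear vscale s g by fact
  have "g u = g (\<Sum>b\<in>Poly_Mapping.keys u. vscale (Poly_Mapping.lookup u b) (basis b))"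
    by (simp flip: basis_expansion)
  then show ?thesis by (simp add: lin_ext_def sum scale)
qed


section \<open>Tensor products\<close>

text \<open>
  The tensor product of the spaces with bases \<open>'a\<close> and \<open>'b\<close> is taken to be the space with basis
  \<open>'a \<times> 'b\<close>; the lemma \<open>tensor_universal\<close> is its universal property.
\<close>

definition tensor :: "('a \<Rightarrow>\<^sub>0 'k::field) \<Rightarrow> ('b \<Rightarrow>\<^sub>0 'k) \<Rightarrow> ('a \<times> 'b \<Rightarrow>\<^sub>0 'k)" where
  "tensor u v = (\<Sum>a\<in>Poly_Mapping.keys u. \<Sum>b\<in>Poly_Mapping.keys v.
     vscale (Poly_Mapping.lookup u a * Poly_Mapping.lookup v b) (basis (a, b)))"

lemma lookup_tensor [simp]:
  "Poly_Mapping.lookup (tensor u v) (a, b) = Poly_Mapping.lookup u a * Poly_Mapping.lookup v b"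
proof -
  have "Poly_Mapping.lookup (tensor u v) (a, b)
      = (\<Sum>a'\<in>Poly_Mapping.keys u. \<Sum>b'\<in>Poly_Mapping.keys v.
          if b' = b then (if a' = a then Poly_Mapping.lookup u a' * Poly_Mapping.lookup v b' else 0) else 0)"
    unfolding tensor_def lookup_sum
    by (intro sum.cong refl) (auto simp: basis_def lookup_single)
  also have "\<dots> = Poly_Mapping.lookup u a * Poly_Mapping.lookup v b"
    by (cases "b \<in> Poly_Mapping.keys v") (auto simp: sum.delta in_keys_iff)
  finally show ?thesis .
qed

lemma tensor_basis: "tensor (basis a) (basis b) = basis (a, b)"
  by (rule poly_mapping_eqI) (auto simp: basis_def lookup_single when_def split: if_splits)

lemma bilinear_tensor: "bilinear_map vscale vscale vscale tensor"
  unfolding bilinear_map_def Vector_Spaces.linear_iff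
  by (auto simp: vector_space_vscale lookup_add algebra_simps intro!: poly_mapping_eqI)

lemma lin_ext_tensor:
  assumes f: "bilinear_map vscale vscale s f"
  shows "lin_ext s (\<lambda>(a, b). f (basis a) (basis b)) (tensor u v) = f u v"
proof -
  have s: "vector_space s"
    using f by (auto simp: bilinear_map_def Vector_Spaces.linear_iff)
  interpret s: vector_space s by fact
  let ?g = "lin_ext s (\<lambda>(a, b). f (basis a) (basis b))"
  interpret g: Vector_Spaces.linear vscale s ?g by (rule linear_lin_ext[OF s])
  have "f u v = lin_ext s (\<lambda>a. f (basis a) v) u"
    using f by (intro linear_eq_lin_ext) (auto simp: bilinear_map_def)
  also have "(\<lambda>a. f (basis a) v) = (\<lambda>a. lin_ext s (\<lambda>b. f (basis a) (basis b)) v)"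
    using f by (intro ext linear_eq_lin_ext) (auto simp: bilinear_map_def)
  also have "lin_ext s \<dots> u = ?g (tensor u v)"
    by (simp add: tensor_def g.sum g.scale s) (simp add: lin_ext_def s.scale_sum_right)
  finally show ?thesis ..
qed

lemma tensor_universal:
  fixes f :: "('a \<Rightarrow>\<^sub>0 'k::field) \<Rightarrow> ('b \<Rightarrow>\<^sub>0 'k) \<Rightarrow> 'w::ab_group_add"
  assumes f: "bilinear_map vscale vscale s f"
  shows "\<exists>!g. Vector_Spaces.linear vscale s g \<and> (\<forall>u v. g (tensor u v) = f u v)"
proof -
  have s: "vector_space s"
    using f by (auto simp: bilinear_map_def Vector_Spaces.linear_iff)
  let ?g = "lin_ext s (\<lambda>(a, b). f (basis a) (basis b))"
  have "h = ?g"
    if "Vector_Spaces.linear vscale s h" "\<forall>u v. h (tensor u v) = f u v" for h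
  proof
    fix x
    have "h x = lin_ext s (\<lambda>p. h (basis p)) x"
      using that(1) by (rule linear_eq_lin_ext)
    also have "(\<lambda>p. h (basis p)) = (\<lambda>(a, b). f (basis a) (basis b))"
      using that(2) by (auto simp flip: tensor_basis)
    finally show "h x = ?g x" .
  qed
  then show ?thesis
    using linear_lin_ext[OF s] lin_ext_tensor[OF f] by blast
qed

definition tensor_map ::
    "(('a \<Rightarrow>\<^sub>0 'k::field) \<Rightarrow> ('c \<Rightarrow>\<^sub>0 'k)) \<Rightarrow> (('b \<Rightarrow>\<^sub>0 'k) \<Rightarrow> ('d \<Rightarrow>\<^sub>0 'k)) \<Rightarrow>
     ('a \<times> 'b \<Rightarrow>\<^sub>0 'k) \<Rightarrow> ('c \<times> 'd \<Rightarrow>\<^sub>0 'k)" where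
  "tensor_map f g = lin_ext vscale (\<lambda>(a, b). tensor (f (basis a)) (g (basis b)))"

lemma bilinear_tensor_comp:
  assumes "Vector_Spaces.linear vscale vscale f" "Vector_Spaces.linear vscale vscale g"
  shows "bilinear_map vscale vscale vscale (\<lambda>u v. tensor (f u) (g v))"
  using assms unfolding bilinear_map_def Vector_Spaces.linear_iff
  by (auto simp: vector_space_vscale lookup_add algebra_simps intro!: poly_mapping_eqI)

lemma tensor_map_tensor:
  assumes "Vector_Spaces.linear vscale vscale f" "Vector_Spaces.linear vscale vscale g"
  shows "tensor_map f g (tensor u v) = tensor (f u) (g v)"
  unfolding tensor_map_def by (rule lin_ext_tensor[OF bilinear_tensor_comp[OF assms]])

definition tensor_assoc :: "(('a \<times> 'b) \<times> 'c \<Rightarrow>\<^sub>0 'k::field) \<Rightarrow> ('a \<times> 'b \<times> 'c \<Rightarrow>\<^sub>0 'k)" where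
  "tensor_assoc = lin_ext vscale (\<lambda>((a, b), c). basis (a, b, c))"

text \<open>
  For a functional \<open>\<epsilon>\<close>, these are \<open>\<epsilon> \<otimes> id\<close> and \<open>id \<otimes> \<epsilon>\<close> followed by the identifications
  \<open>\<K> \<otimes> V = V\<close> and \<open>V \<otimes> \<K> = V\<close>.
\<close>

definition contract_left :: "(('a \<Rightarrow>\<^sub>0 'k::field) \<Rightarrow> 'k) \<Rightarrow> ('a \<times> 'b \<Rightarrow>\<^sub>0 'k) \<Rightarrow> ('b \<Rightarrow>\<^sub>0 'k)" where
  "contract_left \<epsilon> = lin_ext vscale (\<lambda>(a, b). vscale (\<epsilon> (basis a)) (basis b))"

definition contract_right :: "(('b \<Rightarrow>\<^sub>0 'k::field) \<Rightarrow> 'k) \<Rightarrow> ('a \<times> 'b \<Rightarrow>\<^sub>0 'k) \<Rightarrow> ('a \<Rightarrow>\<^sub>0 'k)" where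
  "contract_right \<epsilon> = lin_ext vscale (\<lambda>(a, b). vscale (\<epsilon> (basis b)) (basis a))"

text \<open>The product \<open>(a \<otimes> b)(c \<otimes> d) = ac \<otimes> bd\<close> on the tensor square of an algebra.\<close>

definition tensor_mult ::
    "(('b \<Rightarrow>\<^sub>0 'k::field) \<Rightarrow> ('b \<Rightarrow>\<^sub>0 'k) \<Rightarrow> ('b \<Rightarrow>\<^sub>0 'k)) \<Rightarrow>
     ('b \<times> 'b \<Rightarrow>\<^sub>0 'k) \<Rightarrow> ('b \<times> 'b \<Rightarrow>\<^sub>0 'k) \<Rightarrow> ('b \<times> 'b \<Rightarrow>\<^sub>0 'k)" where
  "tensor_mult mul x y =
     lin_ext vscale (\<lambda>(a, b).
       lin_ext vscale (\<lambda>(c, d).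
         tensor (mul (basis a) (basis c)) (mul (basis b) (basis d))) y) x"

lemma tensor_mult_tensor:
  assumes "bilinear_map vscale vscale vscale mul"
  shows "tensor_mult mul (tensor u v) (tensor u' v') = tensor (mul u u') (mul v v')"
proof -
  have "lin_ext vscale (\<lambda>(c, d). tensor (mul x (basis c)) (mul y (basis d))) (tensor u' v')
      = tensor (mul x u') (mul y v')" for x y
    using assms by (intro lin_ext_tensor bilinear_tensor_comp) (auto simp: bilinear_map_def)
  moreover have "lin_ext vscale (\<lambda>(a, b). tensor (mul (basis a) u') (mul (basis b) v')) (tensor u v)
      = tensor (mul u u') (mul v v')"
    using assms
    by (intro lin_ext_tensor[of vscale "\<lambda>a b. tensor (mul a u') (mul b v')"] bilinear_tensor_comp)
      (auto simp: bilinear_map_def)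
  ultimately show ?thesis by (simp add: tensor_mult_def)
qed


section \<open>Algebras, co-algebras and bi-algebras\<close>

locale unital_algebra =
  fixes mul :: "('b \<Rightarrow>\<^sub>0 'k::field) \<Rightarrow> ('b \<Rightarrow>\<^sub>0 'k) \<Rightarrow> ('b \<Rightarrow>\<^sub>0 'k)" and unit :: "'b \<Rightarrow>\<^sub>0 'k"
  assumes bilinear_mult: "bilinear_map vscale vscale vscale mul"
    and mult_assoc: "mul (mul u v) w = mul u (mul v w)"
    and mult_unit_left: "mul unit u = u"
    and mult_unit_right: "mul u unit = u"

locale counital_coalgebra =
  fixes \<Delta> :: "('b \<Rightarrow>\<^sub>0 'k::field) \<Rightarrow> ('b \<times> 'b \<Rightarrow>\<^sub>0 'k)" and \<epsilon> :: "('b \<Rightarrow>\<^sub>0 'k) \<Rightarrow> 'k"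
  assumes linear_comult: "Vector_Spaces.linear vscale vscale \<Delta>"
    and linear_counit: "Vector_Spaces.linear vscale (*) \<epsilon>"
    and comult_coassoc: "tensor_assoc (tensor_map \<Delta> id (\<Delta> u)) = tensor_map id \<Delta> (\<Delta> u)"
    and counit_left: "contract_left \<epsilon> (\<Delta> u) = u"
    and counit_right: "contract_right \<epsilon> (\<Delta> u) = u"

locale bialgebra = unital_algebra mul unit + counital_coalgebra \<Delta> \<epsilon>
  for mul :: "('b \<Rightarrow>\<^sub>0 'k::field) \<Rightarrow> ('b \<Rightarrow>\<^sub>0 'k) \<Rightarrow> ('b \<Rightarrow>\<^sub>0 'k)" and unit :: "'b \<Rightarrow>\<^sub>0 'k"
    and \<Delta> :: "('b \<Rightarrow>\<^sub>0 'k) \<Rightarrow> ('b \<times> 'b \<Rightarrow>\<^sub>0 'k)" and \<epsilon> :: "('b \<Rightarrow>\<^sub>0 'k) \<Rightarrow> 'k" +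
  assumes comult_mult: "\<Delta> (mul u v) = tensor_mult mul (\<Delta> u) (\<Delta> v)"
    and comult_unit: "\<Delta> unit = tensor unit unit"
    and counit_mult: "\<epsilon> (mul u v) = \<epsilon> u * \<epsilon> v"
    and counit_unit: "\<epsilon> unit = 1"


section \<open>The structure maps induced by the rules\<close>

definition rule_mult ::
    "('c \<Rightarrow> 'c \<Rightarrow> 'c multiplicity) \<Rightarrow> ('c \<Rightarrow>\<^sub>0 'k::field) \<Rightarrow> ('c \<Rightarrow>\<^sub>0 'k) \<Rightarrow> ('c \<Rightarrow>\<^sub>0 'k)" where
  "rule_mult \<kappa> u v =
     lin_ext vscale (\<lambda>\<Gamma>2.
       lin_ext vscale (\<lambda>\<Gamma>1. \<Sum>\<Gamma>\<in>#compose \<kappa> {#\<Gamma>2#} {#\<Gamma>1#}. basis \<Gamma>) v) u"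

definition rule_comult ::
    "('c \<Rightarrow> ('c \<times> 'c) multiplicity) \<Rightarrow> ('c \<Rightarrow>\<^sub>0 'k::field) \<Rightarrow> ('c \<times> 'c \<Rightarrow>\<^sub>0 'k)" where
  "rule_comult \<delta> =
     lin_ext vscale (\<lambda>\<Gamma>. \<Sum>(\<Gamma>'', \<Gamma>')\<in>#decompose \<delta> {#\<Gamma>#}. tensor (basis \<Gamma>'') (basis \<Gamma>'))"

definition rule_counit :: "'c \<Rightarrow> ('c \<Rightarrow>\<^sub>0 'k::field) \<Rightarrow> 'k" where
  "rule_counit void = lin_ext (*) (\<lambda>\<Gamma>. if \<Gamma> = void then 1 else 0)"

end

theory Submission
  imports Defs
begin

text \<open>
  Send a finite multiset of objects to the sum of its elements in the vector space with these objects
  as a basis (\<open>formal_sum\<close>). This map turns sums of multisets into sums of vectors and products of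
  multisets into tensor products, and it carries \<open>compose\<close> to the multiplication and \<open>decompose\<close> to
  the comultiplication. All axioms of a bi-algebra are identities between (multi)linear maps, so it
  suffices to check them on basis objects. There, associativity, the unit laws, coassociativity, the
  counit laws and the multiplicativity of the comultiplication are the images under \<open>formal_sum\<close> of
  the corresponding identities of multisets for the two rules.

  The exception is the multiplicativity of the counit. It requires that \<open>\<Gamma>2 \<triangleleft> \<Gamma>1\<close> avoids the void
  object unless \<open>\<Gamma>2\<close> and \<open>\<Gamma>1\<close> are both void, which none of the conditions says outright. If one of
  the two is void, neutrality gives it. Otherwise let \<open>N\<close> be the multiplicity of the void object in
  \<open>\<Gamma>2 \<triangleleft> \<Gamma>1\<close> and compare the multiplicities of the pair \<open>(void, void)\<close> on the two sides of the
  compatibility condition. Only the void object has this pair among its decompositions, and just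
  once, so on the left it is \<open>N\<close> (\<open>count_decompose_void_void\<close>). On the right, the trivial
  decompositions \<open>(void, \<Gamma>2)\<close>, \<open>(void, \<Gamma>1)\<close> contribute \<open>1 \<cdot> N\<close>, and \<open>(\<Gamma>2, void)\<close>, \<open>(\<Gamma>1, void)\<close>
  contribute \<open>N \<cdot> 1\<close>. Thus \<open>2 N \<le> N\<close>, so \<open>N = 0\<close> (\<open>void_notin_compose\<close>). This is an
  equality of natural numbers, so the argument is valid in every characteristic.
\<close>

section \<open>Linear and bilinear maps determined on a basis\<close>

lemma linear_eqI:
  assumes "Vector_Spaces.linear vscale s f" "Vector_Spaces.linear vscale s g"
    and "\<And>b. f (basis b) = g (basis b)"
  shows "f u = g u"
  using linear_eq_lin_ext[OF assms(1), of u] linear_eq_lin_ext[OF assms(2), of u] assms(3) by simp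

lemma bilinear_mapD:
  assumes "bilinear_map s1 s2 s3 f"
  shows "Vector_Spaces.linear s1 s3 (\<lambda>u. f u v)" "Vector_Spaces.linear s2 s3 (f u)"
  using assms by (auto simp: bilinear_map_def)

lemma bilinear_eqI:
  assumes f: "bilinear_map vscale vscale s f" and g: "bilinear_map vscale vscale s g"
    and "\<And>a b. f (basis a) (basis b) = g (basis a) (basis b)"
  shows "f u v = g u v"
proof -
  have "f (basis a) v = g (basis a) v" for a
    using bilinear_mapD(2)[OF f] bilinear_mapD(2)[OF g] assms(3) by (rule linear_eqI)
  with bilinear_mapD(1)[OF f] bilinear_mapD(1)[OF g] show ?thesis by (rule linear_eqI)
qed

lemma linear_comp:
  assumes "Vector_Spaces.linear s1 s2 f" "Vector_Spaces.linear s2 s3 g"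
  shows "Vector_Spaces.linear s1 s3 (\<lambda>u. g (f u))"
  using assms by (simp add: Vector_Spaces.linear_iff)

lemma linear_lin_ext_comp:
  assumes "vector_space s" "Vector_Spaces.linear t vscale h"
  shows "Vector_Spaces.linear t s (\<lambda>u. lin_ext s f (h u))"
  by (rule linear_comp[OF assms(2) linear_lin_ext[OF assms(1)]])

lemma linear_identity: "vector_space s \<Longrightarrow> Vector_Spaces.linear s s (\<lambda>u. u)"
  by (simp add: Vector_Spaces.linear_iff)

lemma bilinear_linear_comp:
  assumes "bilinear_map s1 s2 s3 f" "Vector_Spaces.linear s3 s4 h"
  shows "bilinear_map s1 s2 s4 (\<lambda>u v. h (f u v))"
  using assms by (simp add: bilinear_map_def Vector_Spaces.linear_iff)

lemma bilinear_comp_linear: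
  assumes "bilinear_map s1 s2 s3 f"
    and "Vector_Spaces.linear t1 s1 g" "Vector_Spaces.linear t2 s2 h"
  shows "bilinear_map t1 t2 s3 (\<lambda>u v. f (g u) (h v))"
  using assms by (simp add: bilinear_map_def Vector_Spaces.linear_iff)

text \<open>
  Both \<open>rule_mult\<close> and \<open>tensor_mult\<close> are nested linear extensions of this form. Linearity in the
  outer argument is built in, whereas in the inner one it uses that scalars commute.
\<close>

lemma bilinear_lin_ext:
  fixes s :: "'k::field \<Rightarrow> 'v::ab_group_add \<Rightarrow> 'v" and f :: "'a \<Rightarrow> 'b \<Rightarrow> 'v"
  assumes "vector_space s"
  shows "bilinear_map vscale vscale s (\<lambda>u v. lin_ext s (\<lambda>a. lin_ext s (f a) v) u)"
proof -
  interpret s: vector_space s by fact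
  have add: "lin_ext s g (x + y) = lin_ext s g x + lin_ext s g y"
    and scale: "lin_ext s g (vscale c x) = s c (lin_ext s g x)" for g :: "'b \<Rightarrow> 'v" and c x y
    using linear_lin_ext[OF assms, of g] by (simp_all add: Vector_Spaces.linear_iff)
  have "Vector_Spaces.linear vscale s (\<lambda>v. lin_ext s (\<lambda>a. lin_ext s (f a) v) u)" for u
    unfolding Vector_Spaces.linear_iff
    by (simp add: assms vector_space_vscale add scale lin_ext_def[of s _ u]
        s.scale_right_distrib sum.distrib s.scale_sum_right mult.commute)
  then show ?thesis
    by (simp add: bilinear_map_def linear_lin_ext[OF assms])
qed

section \<open>Formal sums of multisets\<close>

definition formal_sum :: "'b multiset \<Rightarrow> ('b \<Rightarrow>\<^sub>0 'k::field)" where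
  "formal_sum M = (\<Sum>b\<in>#M. basis b)"

lemma formal_sum_empty [simp]: "formal_sum {#} = 0"
  and formal_sum_add_mset [simp]: "formal_sum (add_mset b M) = basis b + formal_sum M"
  and formal_sum_plus [simp]: "formal_sum (M + N) = formal_sum M + formal_sum N"
  by (simp_all add: formal_sum_def)

lemma lookup_formal_sum:
  "Poly_Mapping.lookup (formal_sum M) b = of_nat (count M b)"
  by (induction M) (auto simp: lookup_add basis_def lookup_single)

lemma formal_sum_sum_mset: "formal_sum (\<Sum>x\<in>#M. F x) = (\<Sum>x\<in>#M. formal_sum (F x))"
  by (induction M) simp_all

lemma linear_sum_mset:
  assumes "Vector_Spaces.linear s t h"
  shows "h (\<Sum>x\<in>#M. F x) = (\<Sum>x\<in>#M. h (F x))"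
proof -
  interpret Vector_Spaces.linear s t h by fact
  show ?thesis by (induction M) (simp_all add: add)
qed

lemma lin_ext_formal_sum:
  assumes "vector_space s"
  shows "lin_ext s f (formal_sum M) = (\<Sum>b\<in>#M. f b)"
  by (simp add: formal_sum_def linear_sum_mset[OF linear_lin_ext[OF assms]] assms)

lemma tensor_formal_sum:
  "tensor (formal_sum A) (formal_sum B) = formal_sum (mset_times A B)"
  by (rule poly_mapping_eqI) (auto simp: lookup_formal_sum count_mset_times)

lemma formal_sum_single: "formal_sum {#b#} = basis b"
  by simp

section \<open>The structure maps on formal sums\<close>

lemma rule_mult_basis:
  "rule_mult \<kappa> (basis a) (basis b) = formal_sum (compose \<kappa> {#a#} {#b#})"
  by (simp add: rule_mult_def vector_space_vscale formal_sum_def)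

lemma rule_mult_formal_sum:
  "rule_mult \<kappa> (formal_sum A) (formal_sum B) = formal_sum (compose \<kappa> A B)"
  unfolding rule_mult_def lin_ext_formal_sum[OF vector_space_vscale]
  by (simp add: compose_def formal_sum_sum_mset flip: formal_sum_def)

lemma rule_comult_formal_sum:
  "rule_comult \<delta> (formal_sum A) = formal_sum (decompose \<delta> A)"
proof -
  have "rule_comult \<delta> (formal_sum A)
      = (\<Sum>\<Gamma>\<in>#A. formal_sum (decompose \<delta> {#\<Gamma>#}))"
    by (simp add: rule_comult_def lin_ext_formal_sum[OF vector_space_vscale] tensor_basis
        formal_sum_def[of "decompose \<delta> _"] case_prod_unfold)
  then show ?thesis by (simp add: decompose_def formal_sum_sum_mset)
qed

lemma rule_comult_basis:
  "rule_comult \<delta> (basis \<Gamma>) = formal_sum (decompose \<delta> {#\<Gamma>#})"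
  by (simp flip: formal_sum_single add: rule_comult_formal_sum del: formal_sum_add_mset)

lemma tensor_assoc_formal_sum:
  "tensor_assoc (formal_sum M) = formal_sum (image_mset (\<lambda>((a, b), c). (a, b, c)) M)"
  by (simp add: tensor_assoc_def lin_ext_formal_sum[OF vector_space_vscale]
      formal_sum_def[of "image_mset _ _"] case_prod_unfold multiset.map_comp comp_def)

lemma tensor_map_formal_sum:
  assumes "\<And>a. f (basis a) = formal_sum (F a)" "\<And>b. g (basis b) = formal_sum (G b)"
  shows "tensor_map f g (formal_sum M) = formal_sum (\<Sum>(a, b)\<in>#M. mset_times (F a) (G b))"
  by (simp add: tensor_map_def lin_ext_formal_sum[OF vector_space_vscale] assms
      tensor_formal_sum formal_sum_sum_mset case_prod_unfold)

lemma tensor_mult_formal_sum: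
  "tensor_mult (rule_mult \<kappa>) (formal_sum P) (formal_sum Q) =
     formal_sum (\<Sum>(a, b)\<in>#P. \<Sum>(c, d)\<in>#Q.
       mset_times (compose \<kappa> {#a#} {#c#}) (compose \<kappa> {#b#} {#d#}))"
  by (simp add: tensor_mult_def lin_ext_formal_sum[OF vector_space_vscale] rule_mult_basis
      tensor_formal_sum formal_sum_sum_mset case_prod_unfold)

lemma vector_space_mult: "vector_space ((*) :: 'k::field \<Rightarrow> 'k \<Rightarrow> 'k)"
  by unfold_locales (auto simp: algebra_simps)

lemma rule_counit_basis: "rule_counit void (basis b) = (if b = void then 1 else 0)"
  by (simp add: rule_counit_def vector_space_mult)

lemma rule_counit_formal_sum: "rule_counit void (formal_sum M) = of_nat (count M void)"
proof -
  have "rule_counit void (formal_sum M) = (\<Sum>b\<in>#M. if b = void then 1 else 0)"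
    by (simp add: rule_counit_def lin_ext_formal_sum[OF vector_space_mult])
  also have "\<dots> = of_nat (count M void)" by (induction M) auto
  finally show ?thesis .
qed

text \<open>
  On basis objects the counit is the indicator of the void object, so contracting with it selects
  pairs. This reduces the counit laws to counting the pairs in a decomposition that have the void
  object in a given place.
\<close>

lemma contract_left_formal_sum:
  "contract_left (rule_counit void) (formal_sum M) = formal_sum (image_mset snd {#p \<in># M. fst p = void#})"
proof -
  have "contract_left (rule_counit void) (formal_sum M)
      = (\<Sum>p\<in>#M. vscale (if fst p = void then 1 else 0) (basis (snd p)))"
    by (simp add: contract_left_def lin_ext_formal_sum[OF vector_space_vscale] rule_counit_basis
        case_prod_unfold)
  also have "\<dots> = formal_sum (image_mset snd {#p \<in># M. fst p = void#})"
    by (induction M) (auto intro!: poly_mapping_eqI simp: lookup_add)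
  finally show ?thesis .
qed

lemma contract_right_formal_sum:
  "contract_right (rule_counit void) (formal_sum M) = formal_sum (image_mset fst {#p \<in># M. snd p = void#})"
proof -
  have "contract_right (rule_counit void) (formal_sum M)
      = (\<Sum>p\<in>#M. vscale (if snd p = void then 1 else 0) (basis (fst p)))"
    by (simp add: contract_right_def lin_ext_formal_sum[OF vector_space_vscale] rule_counit_basis
        case_prod_unfold)
  also have "\<dots> = formal_sum (image_mset fst {#p \<in># M. snd p = void#})"
    by (induction M) (auto intro!: poly_mapping_eqI simp: lookup_add)
  finally show ?thesis .
qed

lemma bilinear_rule_mult: "bilinear_map vscale vscale vscale (rule_mult \<kappa>)"
  unfolding rule_mult_def by (rule bilinear_lin_ext[OF vector_space_vscale])

lemma linear_rule_comult: "Vector_Spaces.linear vscale vscale (rule_comult \<delta>)"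
  unfolding rule_comult_def by (rule linear_lin_ext[OF vector_space_vscale])

lemma linear_rule_counit: "Vector_Spaces.linear vscale (*) (rule_counit void)"
  unfolding rule_counit_def by (rule linear_lin_ext[OF vector_space_mult])

lemma bilinear_tensor_mult: "bilinear_map vscale vscale vscale (tensor_mult mul)"
  unfolding tensor_mult_def case_prod_unfold by (rule bilinear_lin_ext[OF vector_space_vscale])

section \<open>The algebra and the co-algebra\<close>

lemma (in composition_rule) unital_algebra_rule_mult:
  "unital_algebra (rule_mult \<kappa> :: ('c \<Rightarrow>\<^sub>0 'k::field) \<Rightarrow> _) (basis void)"
proof
  note lin = bilinear_mapD[OF bilinear_rule_mult, of \<kappa>]
  show "rule_mult \<kappa> (rule_mult \<kappa> u v) w = rule_mult \<kappa> u (rule_mult \<kappa> v w)"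
    for u v w :: "'c \<Rightarrow>\<^sub>0 'k"
  proof -
    have "bilinear_map vscale vscale vscale (\<lambda>v w :: 'c \<Rightarrow>\<^sub>0 'k.
        rule_mult \<kappa> (rule_mult \<kappa> (basis a) v) w)" for a
      by (rule bilinear_comp_linear[OF bilinear_rule_mult lin(2)
            linear_identity[OF vector_space_vscale]])
    moreover have "bilinear_map vscale vscale vscale (\<lambda>v w :: 'c \<Rightarrow>\<^sub>0 'k.
        rule_mult \<kappa> (basis a) (rule_mult \<kappa> v w))" for a
      by (rule bilinear_linear_comp[OF bilinear_rule_mult lin(2)])
    moreover have "rule_mult \<kappa> (rule_mult \<kappa> (basis a) (basis b)) (basis c)
        = rule_mult \<kappa> (basis a) (rule_mult \<kappa> (basis b) (basis c :: 'c \<Rightarrow>\<^sub>0 'k))" for a b c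
      by (simp only: rule_mult_formal_sum comp_assoc flip: formal_sum_single)
    ultimately have "rule_mult \<kappa> (rule_mult \<kappa> (basis a) v) w
        = rule_mult \<kappa> (basis a) (rule_mult \<kappa> v w)" for a
      by (rule bilinear_eqI)
    with linear_comp[OF lin(1) lin(1)] lin(1) show ?thesis
      by (rule linear_eqI)
  qed
  show "rule_mult \<kappa> (basis void) u = u" for u :: "'c \<Rightarrow>\<^sub>0 'k"
    by (rule linear_eqI[OF lin(2) linear_identity[OF vector_space_vscale]])
      (simp add: rule_mult_basis comp_neutral_left)
  show "rule_mult \<kappa> u (basis void) = u" for u :: "'c \<Rightarrow>\<^sub>0 'k"
    by (rule linear_eqI[OF lin(1) linear_identity[OF vector_space_vscale]])
      (simp add: rule_mult_basis comp_neutral_right)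
qed (rule bilinear_rule_mult)

context decomposition_rule
begin

text \<open>
  A pair with a void component is in particular one of the trivial pairs, so it is found among
  the two that the condition on trivial decompositions lists. For \<open>\<Gamma> \<noteq> void\<close> only one of these
  has the void object in the given place.
\<close>

lemma decompose_void_left: "{#p \<in># decompose \<delta> {#\<Gamma>#}. fst p = void#} = {#(void, \<Gamma>)#}"
proof (cases "\<Gamma> = void")
  case False
  have "{#p \<in># decompose \<delta> {#\<Gamma>#}. fst p = void#}
      = {#p \<in># {#(\<Gamma>'', \<Gamma>') \<in># decompose \<delta> {#\<Gamma>#}. \<Gamma>'' \<in> {void, \<Gamma>} \<or> \<Gamma>' \<in> {void, \<Gamma>}#}. fst p = void#}"
    unfolding filter_filter_mset by (rule filter_mset_cong) auto
  then show ?thesis unfolding decomp_trivial[OF False] by (simp add: False)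
qed (simp add: decomp_void)

lemma decompose_void_right: "{#p \<in># decompose \<delta> {#\<Gamma>#}. snd p = void#} = {#(\<Gamma>, void)#}"
proof (cases "\<Gamma> = void")
  case False
  have "{#p \<in># decompose \<delta> {#\<Gamma>#}. snd p = void#}
      = {#p \<in># {#(\<Gamma>'', \<Gamma>') \<in># decompose \<delta> {#\<Gamma>#}. \<Gamma>'' \<in> {void, \<Gamma>} \<or> \<Gamma>' \<in> {void, \<Gamma>}#}. snd p = void#}"
    unfolding filter_filter_mset by (rule filter_mset_cong) auto
  then show ?thesis unfolding decomp_trivial[OF False] by (simp add: False)
qed (simp add: decomp_void)

lemma counital_coalgebra_rule_comult:
  "counital_coalgebra (rule_comult \<delta> :: ('c \<Rightarrow>\<^sub>0 'k::field) \<Rightarrow> _) (rule_counit void)"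
proof (rule counital_coalgebra.intro)
  note lin = linear_rule_comult[of \<delta>]
  show "tensor_assoc (tensor_map (rule_comult \<delta>) id (rule_comult \<delta> u))
      = tensor_map id (rule_comult \<delta>) (rule_comult \<delta> u)" for u :: "'c \<Rightarrow>\<^sub>0 'k"
  proof -
    have id: "id (basis b) = formal_sum {#b#}" for b :: 'c by simp
    note split_left = tensor_map_formal_sum[where F = "\<lambda>a. decompose \<delta> {#a#}"
        and G = "\<lambda>b. {#b#}", OF rule_comult_basis id]
    note split_right = tensor_map_formal_sum[where F = "\<lambda>a. {#a#}"
        and G = "\<lambda>b. decompose \<delta> {#b#}", OF id rule_comult_basis]
    have "Vector_Spaces.linear vscale vscale
        (\<lambda>u :: 'c \<Rightarrow>\<^sub>0 'k. tensor_assoc (tensor_map (rule_comult \<delta>) id (rule_comult \<delta> u)))"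
      unfolding tensor_assoc_def tensor_map_def
      by (intro linear_lin_ext_comp lin vector_space_vscale)
    moreover have "Vector_Spaces.linear vscale vscale
        (\<lambda>u :: 'c \<Rightarrow>\<^sub>0 'k. tensor_map id (rule_comult \<delta>) (rule_comult \<delta> u))"
      unfolding tensor_map_def
      by (intro linear_lin_ext_comp lin vector_space_vscale)
    moreover have "tensor_assoc (tensor_map (rule_comult \<delta>) id (rule_comult \<delta> (basis \<Gamma>)))
        = tensor_map id (rule_comult \<delta>) (rule_comult \<delta> (basis \<Gamma> :: _ \<Rightarrow>\<^sub>0 'k))" for \<Gamma>
      by (simp only: rule_comult_basis split_left split_right tensor_assoc_formal_sum
          decomp_coassoc)
    ultimately show ?thesis by (rule linear_eqI)
  qed
  show "contract_left (rule_counit void) (rule_comult \<delta> u) = u" for u :: "'c \<Rightarrow>\<^sub>0 'k"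
  proof -
    have "Vector_Spaces.linear vscale vscale
        (\<lambda>u :: 'c \<Rightarrow>\<^sub>0 'k. contract_left (rule_counit void) (rule_comult \<delta> u))"
      unfolding contract_left_def
      by (intro linear_lin_ext_comp lin vector_space_vscale)
    then show ?thesis
      by (rule linear_eqI[OF _ linear_identity[OF vector_space_vscale]])
        (simp add: rule_comult_basis contract_left_formal_sum decompose_void_left)
  qed
  show "contract_right (rule_counit void) (rule_comult \<delta> u) = u" for u :: "'c \<Rightarrow>\<^sub>0 'k"
  proof -
    have "Vector_Spaces.linear vscale vscale
        (\<lambda>u :: 'c \<Rightarrow>\<^sub>0 'k. contract_right (rule_counit void) (rule_comult \<delta> u))"
      unfolding contract_right_def
      by (intro linear_lin_ext_comp lin vector_space_vscale)
    then show ?thesis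
      by (rule linear_eqI[OF _ linear_identity[OF vector_space_vscale]])
        (simp add: rule_comult_basis contract_right_formal_sum decompose_void_right)
  qed
qed (rule linear_rule_comult linear_rule_counit)+

lemma count_decompose_void_void:
  "count (decompose \<delta> A) (void, void) = count A void"
proof -
  have "count (decompose \<delta> {#\<Gamma>#}) (void, void) = (if \<Gamma> = void then 1 else 0)" for \<Gamma>
  proof -
    have "count (decompose \<delta> {#\<Gamma>#}) (void, void)
        = count {#p \<in># decompose \<delta> {#\<Gamma>#}. fst p = void#} (void, void)" by simp
    then show ?thesis unfolding decompose_void_left by auto
  qed
  then show ?thesis
    by (induction A) (auto simp: decompose_def)
qed

end

section \<open>Compatibility\<close>

text \<open>
  The void object is not a composite of nonvoid objects: each of the two ways to split off the void
  object on the same side from both factors reproduces all its occurrences in \<open>\<Gamma>2 \<triangleleft> \<Gamma>1\<close>, so that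
  \<open>(void, void)\<close> would occur at least twice as often in the decomposition of \<open>\<Gamma>2 \<triangleleft> \<Gamma>1\<close> as it does.
\<close>

lemma void_notin_compose:
  assumes "composition_rule \<kappa> void" "decomposition_rule \<delta> void" "compatible_rules \<kappa> \<delta>"
    and "\<Gamma>2 \<noteq> void" "\<Gamma>1 \<noteq> void"
  shows "count (compose \<kappa> {#\<Gamma>2#} {#\<Gamma>1#}) void = 0"
proof -
  interpret C: composition_rule \<kappa> void by fact
  interpret D: decomposition_rule \<delta> void by fact
  define N where "N = count (compose \<kappa> {#\<Gamma>2#} {#\<Gamma>1#}) void"
  define W where "W = (\<lambda>(a, a') (b, b').
    mset_times (compose \<kappa> {#a#} {#b#}) (compose \<kappa> {#a'#} {#b'#}))"
  \<comment> \<open>The two trivial pairs are distinct elements of the multiset; \<open>R2\<close> and \<open>R1\<close> below collect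
    the other decompositions, whose contribution is only known to be nonnegative.\<close>
  have sub: "{#(void, \<Gamma>), (\<Gamma>, void)#} \<subseteq># decompose \<delta> {#\<Gamma>#}" if "\<Gamma> \<noteq> void" for \<Gamma>
    unfolding D.decomp_trivial[OF that, symmetric] by (rule multiset_filter_subset)
  obtain R2 where R2: "decompose \<delta> {#\<Gamma>2#} = {#(void, \<Gamma>2), (\<Gamma>2, void)#} + R2"
    using sub[OF assms(4)] by (auto simp: mset_subset_eq_exists_conv)
  obtain R1 where R1: "decompose \<delta> {#\<Gamma>1#} = {#(void, \<Gamma>1), (\<Gamma>1, void)#} + R1"
    using sub[OF assms(5)] by (auto simp: mset_subset_eq_exists_conv)
  have "N = count (decompose \<delta> (compose \<kappa> {#\<Gamma>2#} {#\<Gamma>1#})) (void, void)"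
    by (simp add: N_def D.count_decompose_void_void)
  also have "decompose \<delta> (compose \<kappa> {#\<Gamma>2#} {#\<Gamma>1#})
      = (\<Sum>p\<in>#decompose \<delta> {#\<Gamma>2#}. \<Sum>q\<in>#decompose \<delta> {#\<Gamma>1#}. W p q)"
    using assms(3) by (simp add: compatible_rules_def W_def case_prod_unfold)
  also have "count \<dots> (void, void) \<ge>
      count (W (void, \<Gamma>2) (void, \<Gamma>1)) (void, void) + count (W (\<Gamma>2, void) (\<Gamma>1, void)) (void, void)"
    by (simp add: R1 R2)
  also have "count (W (void, \<Gamma>2) (void, \<Gamma>1)) (void, void) = N"
    by (simp add: W_def count_mset_times N_def C.comp_neutral_left)
  also have "count (W (\<Gamma>2, void) (\<Gamma>1, void)) (void, void) = N"
    by (simp add: W_def count_mset_times N_def C.comp_neutral_left)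
  finally show ?thesis by (simp add: N_def)
qed

theorem theorem1:
  fixes \<kappa> :: "'c::countable \<Rightarrow> 'c \<Rightarrow> 'c multiplicity"
    and \<delta> :: "'c \<Rightarrow> ('c \<times> 'c) multiplicity"
    and void :: 'c
  assumes "composition_rule \<kappa> void"
    and "decomposition_rule \<delta> void"
    and "compatible_rules \<kappa> \<delta>"
  shows "bialgebra
           (rule_mult \<kappa> :: ('c \<Rightarrow>\<^sub>0 'k::field) \<Rightarrow> ('c \<Rightarrow>\<^sub>0 'k) \<Rightarrow> ('c \<Rightarrow>\<^sub>0 'k))
           (basis void) (rule_comult \<delta>) (rule_counit void)"
proof -
  interpret C: composition_rule \<kappa> void by fact
  interpret D: decomposition_rule \<delta> void by fact
  interpret A: unital_algebra "rule_mult \<kappa> :: ('c \<Rightarrow>\<^sub>0 'k) \<Rightarrow> _" "basis void"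
    by (rule C.unital_algebra_rule_mult)
  interpret B: counital_coalgebra "rule_comult \<delta> :: ('c \<Rightarrow>\<^sub>0 'k) \<Rightarrow> _" "rule_counit void"
    by (rule D.counital_coalgebra_rule_comult)
  show ?thesis
  proof
    show "rule_comult \<delta> (rule_mult \<kappa> u v)
        = tensor_mult (rule_mult \<kappa>) (rule_comult \<delta> u) (rule_comult \<delta> v)" for u v :: "'c \<Rightarrow>\<^sub>0 'k"
    proof -
      have "bilinear_map vscale vscale vscale
          (\<lambda>u v :: 'c \<Rightarrow>\<^sub>0 'k. rule_comult \<delta> (rule_mult \<kappa> u v))"
        by (rule bilinear_linear_comp[OF bilinear_rule_mult linear_rule_comult])
      moreover have "bilinear_map vscale vscale vscale (\<lambda>u v :: 'c \<Rightarrow>\<^sub>0 'k.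
          tensor_mult (rule_mult \<kappa>) (rule_comult \<delta> u) (rule_comult \<delta> v))"
        by (rule bilinear_comp_linear[OF bilinear_tensor_mult linear_rule_comult linear_rule_comult])
      moreover have "rule_comult \<delta> (rule_mult \<kappa> (basis \<Gamma>2) (basis \<Gamma>1)) = tensor_mult (rule_mult \<kappa>)
          (rule_comult \<delta> (basis \<Gamma>2)) (rule_comult \<delta> (basis \<Gamma>1) :: _ \<Rightarrow>\<^sub>0 'k)" for \<Gamma>2 \<Gamma>1
        using assms(3)
        by (simp add: rule_mult_basis rule_comult_basis rule_comult_formal_sum
            tensor_mult_formal_sum compatible_rules_def)
      ultimately show ?thesis by (rule bilinear_eqI)
    qed
    show "rule_comult \<delta> (basis void) = tensor (basis void) (basis void :: _ \<Rightarrow>\<^sub>0 'k)"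
      by (simp add: rule_comult_basis D.decomp_void tensor_basis)
    show "rule_counit void (rule_mult \<kappa> u v) = rule_counit void u * rule_counit void v"
      for u v :: "'c \<Rightarrow>\<^sub>0 'k"
    proof -
      have counit_linear:
        "Vector_Spaces.linear vscale (*) (rule_counit void :: ('c \<Rightarrow>\<^sub>0 'k) \<Rightarrow> 'k)"
        by (rule linear_rule_counit)
      have "bilinear_map vscale vscale (*)
          (\<lambda>u v :: 'c \<Rightarrow>\<^sub>0 'k. rule_counit void (rule_mult \<kappa> u v))"
        by (rule bilinear_linear_comp[OF bilinear_rule_mult linear_rule_counit])
      moreover have "bilinear_map vscale vscale (*)
          (\<lambda>u v :: 'c \<Rightarrow>\<^sub>0 'k. rule_counit void u * rule_counit void v)"
        using counit_linear by (simp add: bilinear_map_def Vector_Spaces.linear_iff algebra_simps)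
      moreover have "rule_counit void (rule_mult \<kappa> (basis \<Gamma>2) (basis \<Gamma>1))
          = rule_counit void (basis \<Gamma>2) * rule_counit void (basis \<Gamma>1 :: _ \<Rightarrow>\<^sub>0 'k)" for \<Gamma>2 \<Gamma>1
        using void_notin_compose[OF assms, of \<Gamma>2 \<Gamma>1]
        by (auto simp: rule_mult_basis rule_counit_formal_sum rule_counit_basis
            C.comp_neutral_left C.comp_neutral_right)
      ultimately show ?thesis by (rule bilinear_eqI)
    qed
    show "rule_counit void (basis void) = (1 :: 'k)"
      by (simp add: rule_counit_basis)
  qed
qed

end
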